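(* Let $R$ be a po-ring and let $A$ be a partially ordered right $R$-module. If $R$ is right po-coherent and $A$ is finitely po-presented, then $A$ is po-coherent.
   Context: Rings are associative and unital; modules are unital right modules. A po-ring is a ring $R$ with a partial ordering $\leq$ such that: $x\leq y$ implies $x+z\leq y+z$, and, if $z\geq 0$, also $xz\leq yz$ and $zx\leq zy$; $R$ is directed, i.e. $R=R^++(-R^+)$ where $R^+=\{x\in R: x\geq 0\}$; and $0\leq 1$. A partially ordered right $R$-module is a right $R$-module $A$ with a partial ordering such that $x\leq y$ implies $x+z\leq y+z$ and, for $\lambda\in R^+$, $x\lambda\leq y\lambda$. A right $R^+$-(sub)semimodule is an additive (sub)monoid closed under right multiplication by scalars in $R^+$; it is finitely generated if it consists of all right linear combinations, with coefficients in $R^+$, of some finite subset of itself. For a set $S$, $\mathfrak{M}_{m,n}(S)$ is the set of $m\times n$ matrices with entries in $S$; matrices are ordered entrywise. A row matrix $U\in\mathfrak{M}_{1,n}(A)$ ($n\geq 1$) is spanning if its entries generate $A$ as a right $R$-module. $A$ is finitely po-presented at $U\in\mathfrak{M}_{1,n}(A)$ if $\{X\in\mathfrak{M}_{n,1}(R): UX\geq 0\}$ is a finitely generated right $R^+$-subsemimodule of $\mathfrak{M}_{n,1}(R)$; $A$ is finitely po-presented if it is finitely po-presented at some spanning row matrix (in particular $A$ is then a finitely generated right $R$-module). $A$ is finitely related at $U\in\mathfrak{M}_{1,n}(A)$ if $\{X\in\mathfrak{M}_{n,1}(R): UX\geq 0 \text{ and } X\geq 0\}$ is a finitely generated right $R^+$-subsemimodule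 of $\mathfrak{M}_{n,1}(R)$; $A$ is finitely related if $A$ is a finitely generated right $R$-module and $A$ is finitely related at every spanning row matrix of elements of $A$. $A$ is po-coherent if every finitely generated submodule of $A$ (with the induced ordering) is finitely related; equivalently, $A$ is finitely related at every row matrix of elements of $A$. $R$ is right po-coherent if $R$, viewed as a partially ordered right $R$-module, is po-coherent. *)

theory Defs
  imports "Jordan_Normal_Form.Matrix"
begin

text \<open>The type class \<^class>\<open>monoid_mult\<close> provides a unit without requiring \<open>0 \<noteq> 1\<close>, so the
  zero ring is admitted. Translation invariance of the order and monotonicity of left and right
  multiplication by nonnegative elements are part of \<^class>\<open>ordered_ring\<close>.\<close>

class po_ring = ordered_ring + monoid_mult +
  assumes directed: "\<exists>a b. 0 \<le> a \<and> 0 \<le> b \<and> x = a - b"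
    and one_nonneg: "0 \<le> 1"

text \<open>The scalar action is written \<open>act x r\<close> for the right action of \<open>r\<close> on \<open>x\<close>.\<close>

locale po_right_module =
  fixes act :: "'m::ordered_ab_group_add \<Rightarrow> 'r::po_ring \<Rightarrow> 'm"
  assumes act_add_left: "act (x + y) r = act x r + act y r"
    and act_add_right: "act x (r + s) = act x r + act x s"
    and act_mult: "act x (r * s) = act (act x r) s"
    and act_one: "act x 1 = x"
    and act_mono: "x \<le> y \<Longrightarrow> 0 \<le> r \<Longrightarrow> act x r \<le> act y r"

lemma po_right_module_ring: "po_right_module ((*) :: 'r::po_ring \<Rightarrow> 'r \<Rightarrow> 'r)"
  by standard (simp_all add: distrib_left distrib_right mult.assoc mult_right_mono)

definition right_submodule :: "('m::ordered_ab_group_add \<Rightarrow> 'r::po_ring \<Rightarrow> 'm) \<Rightarrow> 'm set \<Rightarrow> bool" where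
  "right_submodule act B \<longleftrightarrow>
     0 \<in> B \<and> (\<forall>x\<in>B. \<forall>y\<in>B. x + y \<in> B) \<and> (\<forall>x\<in>B. \<forall>r. act x r \<in> B)"

definition fg_submodule :: "('m::ordered_ab_group_add \<Rightarrow> 'r::po_ring \<Rightarrow> 'm) \<Rightarrow> 'm set \<Rightarrow> bool" where
  "fg_submodule act B \<longleftrightarrow> (\<exists>G. finite G \<and> right_submodule act hull G = B)"

text \<open>Column matrices with \<open>n\<close> rows over the ring are vectors in \<open>carrier_vec n\<close>; row matrices
  over the module are also represented as vectors.\<close>

definition row_times_col ::
  "('m::ordered_ab_group_add \<Rightarrow> 'r::po_ring \<Rightarrow> 'm) \<Rightarrow> 'm vec \<Rightarrow> 'r vec \<Rightarrow> 'm" where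
  "row_times_col act U X = (\<Sum>i<dim_vec U. act (U $ i) (X $ i))"

definition pos_subsemimodule :: "nat \<Rightarrow> 'r::po_ring vec set \<Rightarrow> bool" where
  "pos_subsemimodule n S \<longleftrightarrow>
     S \<subseteq> carrier_vec n \<and> 0\<^sub>v n \<in> S \<and> (\<forall>X\<in>S. \<forall>Y\<in>S. X + Y \<in> S) \<and>
     (\<forall>X\<in>S. \<forall>r\<ge>0. map_vec (\<lambda>x. x * r) X \<in> S)"

definition pos_right_combinations :: "nat \<Rightarrow> 'r::po_ring vec set \<Rightarrow> 'r vec set" where
  "pos_right_combinations n G =
     {vec n (\<lambda>i. \<Sum>g\<in>G. g $ i * c g) | c. \<forall>g\<in>G. 0 \<le> c g}"

definition fg_pos_subsemimodule :: "nat \<Rightarrow> 'r::po_ring vec set \<Rightarrow> bool" where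
  "fg_pos_subsemimodule n S \<longleftrightarrow>
     pos_subsemimodule n S \<and> (\<exists>G. finite G \<and> G \<subseteq> S \<and> S = pos_right_combinations n G)"

text \<open>In the notions below, a submodule \<open>B\<close> of the ambient module is regarded as a partially
  ordered module with the induced ordering; the ambient module itself is the case
  \<open>B = UNIV\<close>.\<close>

definition spanning_row ::
  "('m::ordered_ab_group_add \<Rightarrow> 'r::po_ring \<Rightarrow> 'm) \<Rightarrow> 'm set \<Rightarrow> 'm vec \<Rightarrow> bool" where
  "spanning_row act B U \<longleftrightarrow>
     dim_vec U \<ge> 1 \<and> set\<^sub>v U \<subseteq> B \<and> right_submodule act hull (set\<^sub>v U) = B"

definition finitely_po_presented_at ::
  "('m::ordered_ab_group_add \<Rightarrow> 'r::po_ring \<Rightarrow> 'm) \<Rightarrow> 'm vec \<Rightarrow> bool" where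
  "finitely_po_presented_at act U \<longleftrightarrow>
     fg_pos_subsemimodule (dim_vec U)
       {X \<in> carrier_vec (dim_vec U). 0 \<le> row_times_col act U X}"

definition finitely_po_presented ::
  "('m::ordered_ab_group_add \<Rightarrow> 'r::po_ring \<Rightarrow> 'm) \<Rightarrow> bool" where
  "finitely_po_presented act \<longleftrightarrow>
     (\<exists>U. spanning_row act UNIV U \<and> finitely_po_presented_at act U)"

definition finitely_related_at ::
  "('m::ordered_ab_group_add \<Rightarrow> 'r::po_ring \<Rightarrow> 'm) \<Rightarrow> 'm vec \<Rightarrow> bool" where
  "finitely_related_at act U \<longleftrightarrow>
     fg_pos_subsemimodule (dim_vec U)
       {X \<in> carrier_vec (dim_vec U). 0 \<le> row_times_col act U X \<and> 0\<^sub>v (dim_vec U) \<le> X}"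

definition finitely_related ::
  "('m::ordered_ab_group_add \<Rightarrow> 'r::po_ring \<Rightarrow> 'm) \<Rightarrow> 'm set \<Rightarrow> bool" where
  "finitely_related act B \<longleftrightarrow>
     fg_submodule act B \<and> (\<forall>U. spanning_row act B U \<longrightarrow> finitely_related_at act U)"

definition po_coherent ::
  "('m::ordered_ab_group_add \<Rightarrow> 'r::po_ring \<Rightarrow> 'm) \<Rightarrow> bool" where
  "po_coherent act \<longleftrightarrow> (\<forall>B. fg_submodule act B \<longrightarrow> finitely_related act B)"

definition right_po_coherent :: "'r::po_ring itself \<Rightarrow> bool" where
  "right_po_coherent _ \<longleftrightarrow> po_coherent ((*) :: 'r \<Rightarrow> 'r \<Rightarrow> 'r)"

end

theory Submission
  imports Defs
begin

text \<open>Fix a spanning row \<open>U\<close> such that \<open>U X \<ge> 0\<close> holds precisely when \<open>X = G Z\<close> for some \<open>Z \<ge> 0\<close>,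
  where \<open>G\<close> is a matrix over the ring. An arbitrary row \<open>V\<close> over the module can be written \<open>U W\<close>,
  so for \<open>Y \<ge> 0\<close> the condition \<open>V Y \<ge> 0\<close> holds if and only if \<open>W Y = G Z\<close> for some \<open>Z \<ge> 0\<close>.
  Hence the set in question is a projection of the set of nonnegative solutions \<open>(Y, Z)\<close> of a
  finite system of linear inequalities over the ring. Right po-coherence makes such a solution set
  finitely generated, by induction on the number of inequalities: if the nonnegative solutions so
  far are \<open>H Z\<close> with \<open>Z \<ge> 0\<close>, a further inequality \<open>u X \<ge> 0\<close> becomes the single inequality
  \<open>(u H) Z \<ge> 0\<close>.\<close>

section \<open>Finitely generated semimodules of column vectors\<close>

text \<open>Together with the next two lemmas this makes \<open>pos_right_combinations n G\<close>
  the least subsemimodule containing a finite set \<open>G\<close> of columns, so inclusions can be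
  checked on generators.\<close>

lemma pos_right_combinations_minimal:
  assumes "finite G" "pos_subsemimodule n S" "G \<subseteq> S"
  shows "pos_right_combinations n G \<subseteq> S"
proof -
  have "vec n (\<lambda>i. \<Sum>g\<in>G. g $ i * c g) \<in> S" if "\<forall>g\<in>G. 0 \<le> c g" for c
    using assms(1,3) that
  proof (induction G rule: finite_induct)
    case empty
    have "vec n (\<lambda>i. \<Sum>g\<in>{}. g $ i * c g) = 0\<^sub>v n"
      by auto
    then show ?case
      using assms(2) by (simp add: pos_subsemimodule_def)
  next
    case (insert g G)
    have g: "g \<in> carrier_vec n"
      using insert.prems assms(2) by (auto simp: pos_subsemimodule_def)
    have "vec n (\<lambda>i. \<Sum>h\<in>insert g G. h $ i * c h)
        = map_vec (\<lambda>x. x * c g) g + vec n (\<lambda>i. \<Sum>h\<in>G. h $ i * c h)"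
      using insert.hyps g by (intro eq_vecI) auto
    then show ?case
      using insert assms(2) by (simp add: pos_subsemimodule_def)
  qed
  then show ?thesis
    by (auto simp: pos_right_combinations_def)
qed

lemma pos_subsemimodule_pos_right_combinations:
  "pos_subsemimodule n (pos_right_combinations n G)"
  unfolding pos_subsemimodule_def
proof (intro conjI ballI allI impI)
  show "pos_right_combinations n G \<subseteq> carrier_vec n"
    by (auto simp: pos_right_combinations_def)
  show "0\<^sub>v n \<in> pos_right_combinations n G"
    unfolding pos_right_combinations_def mem_Collect_eq
    by (rule exI[of _ "\<lambda>_. 0"]) auto
next
  fix X Y assume "X \<in> pos_right_combinations n G" "Y \<in> pos_right_combinations n G"
  then obtain c d where c: "\<forall>g\<in>G. 0 \<le> c g" "X = vec n (\<lambda>i. \<Sum>g\<in>G. g $ i * c g)"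
    and d: "\<forall>g\<in>G. 0 \<le> d g" "Y = vec n (\<lambda>i. \<Sum>g\<in>G. g $ i * d g)"
    unfolding pos_right_combinations_def by blast
  have "X + Y = vec n (\<lambda>i. \<Sum>g\<in>G. g $ i * (c g + d g))"
    using c d by (auto simp: distrib_left sum.distrib)
  then show "X + Y \<in> pos_right_combinations n G"
    using c d unfolding pos_right_combinations_def by fastforce
next
  fix X and r :: 'a assume "X \<in> pos_right_combinations n G" and r: "0 \<le> r"
  then obtain c where c: "\<forall>g\<in>G. 0 \<le> c g" "X = vec n (\<lambda>i. \<Sum>g\<in>G. g $ i * c g)"
    unfolding pos_right_combinations_def by blast
  have "map_vec (\<lambda>x. x * r) X = vec n (\<lambda>i. \<Sum>g\<in>G. g $ i * (c g * r))"
    using c by (auto simp: sum_distrib_right mult.assoc)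
  then show "map_vec (\<lambda>x. x * r) X \<in> pos_right_combinations n G"
    using c r unfolding pos_right_combinations_def by fastforce
qed

text \<open>A generator has coefficient 1 at itself and 0 elsewhere; the axiom
  \<open>one_nonneg\<close> makes these coefficients admissible.\<close>

lemma generators_in_pos_right_combinations:
  assumes "finite G" "G \<subseteq> carrier_vec n"
  shows "G \<subseteq> pos_right_combinations n G"
proof
  fix g assume g: "g \<in> G"
  have "g $ i = (\<Sum>h\<in>G. h $ i * (if h = g then 1 else 0))" for i
  proof -
    have "(\<Sum>h\<in>G. h $ i * (if h = g then 1 else 0)) = (\<Sum>h\<in>G. if h = g then h $ i else 0)"
      by (intro sum.cong) auto
    also have "\<dots> = g $ i"
      using g assms(1) by simp
    finally show ?thesis ..
  qed
  then have "g = vec n (\<lambda>i. \<Sum>h\<in>G. h $ i * (if h = g then 1 else 0))"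
    using g assms(2) by (intro eq_vecI) auto
  moreover have "\<forall>h\<in>G. (0::'a) \<le> (if h = g then 1 else 0)"
    by (simp add: one_nonneg)
  ultimately show "g \<in> pos_right_combinations n G"
    unfolding pos_right_combinations_def mem_Collect_eq
    by (intro exI[of _ "\<lambda>h. if h = g then 1 else 0"] conjI)
qed

text \<open>The images of generators generate the image. Stating this for any additive, right
  homogeneous \<open>F\<close> covers both multiplication by a matrix and the projection
  \<open>vec_first\<close>.\<close>

lemma fg_pos_subsemimodule_image:
  fixes F :: "'r::po_ring vec \<Rightarrow> 'r vec"
  assumes fg: "fg_pos_subsemimodule n S"
    and carrier: "\<And>X. X \<in> carrier_vec n \<Longrightarrow> F X \<in> carrier_vec p"
    and zero: "F (0\<^sub>v n) = 0\<^sub>v p"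
    and add: "\<And>X Y. X \<in> carrier_vec n \<Longrightarrow> Y \<in> carrier_vec n \<Longrightarrow> F (X + Y) = F X + F Y"
    and scale: "\<And>X r. X \<in> carrier_vec n \<Longrightarrow>
      F (map_vec (\<lambda>x. x * r) X) = map_vec (\<lambda>x. x * r) (F X)"
  shows "fg_pos_subsemimodule p (F ` S)"
proof -
  obtain G where S: "pos_subsemimodule n S" and G: "finite G" "G \<subseteq> S" "S = pos_right_combinations n G"
    using fg by (auto simp: fg_pos_subsemimodule_def)
  have Sc: "X \<in> carrier_vec n" if "X \<in> S" for X
    using S that by (auto simp: pos_subsemimodule_def)
  have image: "pos_subsemimodule p (F ` S)"
    using S Sc carrier unfolding pos_subsemimodule_def
    by (auto simp: zero add[symmetric] scale[symmetric] image_iff intro: zero[symmetric])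
  let ?C = "pos_right_combinations p (F ` G)"
  have C: "pos_subsemimodule p ?C"
    by (rule pos_subsemimodule_pos_right_combinations)
  \<comment> \<open>The part of \<open>S\<close> that \<open>F\<close> maps into \<open>?C\<close>
    is a subsemimodule; as it contains \<open>G\<close>, minimality makes it all of
    \<open>S\<close>, without applying \<open>F\<close> to explicit sums.\<close>
  have "pos_subsemimodule n {X \<in> S. F X \<in> ?C}"
    using S C Sc unfolding pos_subsemimodule_def by (auto simp: zero add scale)
  moreover have "F ` G \<subseteq> ?C"
    using G Sc carrier by (intro generators_in_pos_right_combinations) auto
  ultimately have "S \<subseteq> {X \<in> S. F X \<in> ?C}"
    using pos_right_combinations_minimal[OF G(1)] G by blast
  then have "F ` S \<subseteq> ?C"
    by blast
  moreover have "?C \<subseteq> F ` S"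
    using G by (intro pos_right_combinations_minimal image) auto
  ultimately show ?thesis
    using image G by (auto simp: fg_pos_subsemimodule_def intro!: exI[of _ "F ` G"])
qed

lemma fg_pos_subsemimodule_mat_image:
  assumes "fg_pos_subsemimodule n S" "P \<in> carrier_mat p n"
  shows "fg_pos_subsemimodule p ((*\<^sub>v) P ` S)"
proof (rule fg_pos_subsemimodule_image[OF assms(1)])
  show "P *\<^sub>v X \<in> carrier_vec p" if "X \<in> carrier_vec n" for X
    using assms that by simp
  show "P *\<^sub>v 0\<^sub>v n = 0\<^sub>v p"
    using assms by (intro eq_vecI) auto
  show "P *\<^sub>v (X + Y) = P *\<^sub>v X + P *\<^sub>v Y"
    if "X \<in> carrier_vec n" "Y \<in> carrier_vec n" for X Y
    using assms that by (simp add: mult_add_distrib_mat_vec)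
  show "P *\<^sub>v map_vec (\<lambda>x. x * r) X = map_vec (\<lambda>x. x * r) (P *\<^sub>v X)"
    if "X \<in> carrier_vec n" for X r
    using assms that
    by (intro eq_vecI) (auto simp: scalar_prod_def sum_distrib_right mult.assoc)
qed

text \<open>The columns of \<open>H\<close> enumerate the generators. This parametrization by
  nonnegative vectors allows substitution into further inequalities.\<close>

lemma fg_pos_subsemimodule_matrix:
  assumes "fg_pos_subsemimodule n S"
  obtains k H where "H \<in> carrier_mat n k"
    "S = (*\<^sub>v) H ` {Z \<in> carrier_vec k. 0\<^sub>v k \<le> Z}"
proof -
  obtain G where G: "finite G" "S = pos_right_combinations n G"
    using assms by (auto simp: fg_pos_subsemimodule_def)
  obtain h where h: "bij_betw h {0..<card G} G"
    using ex_bij_betw_nat_finite[OF G(1)] by blast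
  define H where "H = mat n (card G) (\<lambda>(i, j). h j $ i)"
  have "S = (*\<^sub>v) H ` {Z \<in> carrier_vec (card G). 0\<^sub>v (card G) \<le> Z}"
  proof (intro equalityI subsetI)
    fix X assume "X \<in> S"
    then obtain c where c: "\<forall>g\<in>G. 0 \<le> c g" "X = vec n (\<lambda>i. \<Sum>g\<in>G. g $ i * c g)"
      unfolding G pos_right_combinations_def by blast
    let ?Z = "vec (card G) (\<lambda>j. c (h j))"
    have "X = H *\<^sub>v ?Z"
      unfolding c
    proof (intro eq_vecI)
      fix i assume "i < dim_vec (H *\<^sub>v ?Z)"
      then show "vec n (\<lambda>i. \<Sum>g\<in>G. g $ i * c g) $ i = (H *\<^sub>v ?Z) $ i"
        by (simp add: H_def scalar_prod_def sum.reindex_bij_betw[OF h, symmetric])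
    qed (simp add: H_def)
    moreover have "0\<^sub>v (card G) \<le> ?Z"
      using c h by (auto simp: less_eq_vec_def bij_betw_def)
    ultimately show "X \<in> (*\<^sub>v) H ` {Z \<in> carrier_vec (card G). 0\<^sub>v (card G) \<le> Z}"
      by auto
  next
    fix X assume "X \<in> (*\<^sub>v) H ` {Z \<in> carrier_vec (card G). 0\<^sub>v (card G) \<le> Z}"
    then obtain Z where Z: "Z \<in> carrier_vec (card G)" "0\<^sub>v (card G) \<le> Z" "X = H *\<^sub>v Z"
      by auto
    define c where "c g = Z $ the_inv_into {0..<card G} h g" for g
    have ch: "c (h j) = Z $ j" if "j < card G" for j
      using that h by (simp add: c_def the_inv_into_f_f bij_betw_def)
    have "\<forall>g\<in>G. 0 \<le> c g"
    proof
      fix g assume "g \<in> G"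
      then obtain j where "j < card G" "g = h j"
        using bij_betw_imp_surj_on[OF h] by force
      then show "0 \<le> c g"
        using Z ch by (simp add: less_eq_vec_def)
    qed
    moreover have "X = vec n (\<lambda>i. \<Sum>g\<in>G. g $ i * c g)"
      using Z(1) unfolding Z(3)
      by (intro eq_vecI)
        (auto simp: H_def scalar_prod_def ch sum.reindex_bij_betw[OF h, symmetric] intro!: sum.cong)
    ultimately show "X \<in> S"
      unfolding G pos_right_combinations_def by blast
  qed
  then show thesis
    by (rule that[rotated]) (simp add: H_def)
qed

section \<open>Linear inequalities over a right po-coherent ring\<close>

text \<open>Coherence is applied to the right ideal generated by the entries of \<open>w\<close>,
  for which \<open>w\<close> is a spanning row. Spanning rows are nonempty, so \<open>n = 0\<close>
  is treated apart.\<close>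

lemma right_po_coherent_row:
  fixes w :: "'r::po_ring vec"
  assumes "right_po_coherent TYPE('r)" and w: "w \<in> carrier_vec n"
  shows "fg_pos_subsemimodule n {X \<in> carrier_vec n. 0\<^sub>v n \<le> X \<and> 0 \<le> w \<bullet> X}"
proof (cases "n = 0")
  case True
  have "{X \<in> carrier_vec n. 0\<^sub>v n \<le> X \<and> 0 \<le> w \<bullet> X} = pos_right_combinations n {}"
    using True by (auto simp: pos_right_combinations_def scalar_prod_def less_eq_vec_def)
  then show ?thesis
    using pos_subsemimodule_pos_right_combinations[of n "{}"]
    by (auto simp: fg_pos_subsemimodule_def)
next
  case False
  let ?B = "right_submodule ((*) :: 'r \<Rightarrow> 'r \<Rightarrow> 'r) hull set\<^sub>v w"
  have "finite (set\<^sub>v w)"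
    by (simp add: vec_set_def)
  then have "fg_submodule (*) ?B"
    by (auto simp: fg_submodule_def)
  moreover have "spanning_row (*) ?B w"
    using False w by (simp add: spanning_row_def hull_subset)
  ultimately have "finitely_related_at (*) w"
    using assms(1) by (auto simp: right_po_coherent_def po_coherent_def finitely_related_def)
  moreover have "row_times_col (*) w X = w \<bullet> X" if "X \<in> carrier_vec n" for X
    using w that by (simp add: row_times_col_def scalar_prod_def lessThan_atLeast0)
  ultimately show ?thesis
    using w by (simp add: finitely_related_at_def conj_commute cong: conj_cong)
qed

lemma right_po_coherent_system:
  fixes ws :: "'r::po_ring vec set"
  assumes coh: "right_po_coherent TYPE('r)" and "finite ws" "ws \<subseteq> carrier_vec n"
  shows "fg_pos_subsemimodule n {X \<in> carrier_vec n. 0\<^sub>v n \<le> X \<and> (\<forall>w\<in>ws. 0 \<le> w \<bullet> X)}"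
  using assms(2,3)
proof (induction ws rule: finite_induct)
  case empty
  \<comment> \<open>Adding the trivial inequality with zero row reduces the base case to the case of
    one row.\<close>
  have "{X \<in> carrier_vec n. 0\<^sub>v n \<le> X \<and> (\<forall>w\<in>{} :: 'r vec set. 0 \<le> w \<bullet> X)}
      = {X \<in> carrier_vec n. 0\<^sub>v n \<le> X \<and> 0 \<le> 0\<^sub>v n \<bullet> X}"
    by auto
  then show ?case
    using right_po_coherent_row[OF coh, of "0\<^sub>v n" n] by simp
next
  case (insert w ws)
  let ?S = "{X \<in> carrier_vec n. 0\<^sub>v n \<le> X \<and> (\<forall>w\<in>ws. 0 \<le> w \<bullet> X)}"
  have w: "w \<in> carrier_vec n"
    using insert.prems by simp
  obtain k H where H: "H \<in> carrier_mat n k" "?S = (*\<^sub>v) H ` {Z \<in> carrier_vec k. 0\<^sub>v k \<le> Z}"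
    using insert.prems by (auto intro: fg_pos_subsemimodule_matrix[OF insert.IH])
  \<comment> \<open>This is the row \<open>w\<close> times \<open>H\<close>: the new inequality
    pulled back to the parameters \<open>Z\<close>.\<close>
  define v where "v = vec k (\<lambda>j. w \<bullet> col H j)"
  have vw: "v \<bullet> Z = w \<bullet> (H *\<^sub>v Z)" if "Z \<in> carrier_vec k" for Z
  proof -
    have "v \<bullet> Z = (\<Sum>j<k. \<Sum>i<n. w $ i * H $$ (i, j) * Z $ j)"
      using H(1) w that
      by (auto simp: v_def scalar_prod_def lessThan_atLeast0 sum_distrib_right intro!: sum.cong)
    also have "\<dots> = (\<Sum>i<n. \<Sum>j<k. w $ i * H $$ (i, j) * Z $ j)"
      by (rule sum.swap)
    also have "\<dots> = w \<bullet> (H *\<^sub>v Z)"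
      using H(1) w that
      by (auto simp: scalar_prod_def lessThan_atLeast0 sum_distrib_left mult.assoc intro!: sum.cong)
    finally show ?thesis .
  qed
  have "{X \<in> carrier_vec n. 0\<^sub>v n \<le> X \<and> (\<forall>w\<in>insert w ws. 0 \<le> w \<bullet> X)} = {X \<in> ?S. 0 \<le> w \<bullet> X}"
    by auto
  also have "\<dots> = (*\<^sub>v) H ` {Z \<in> carrier_vec k. 0\<^sub>v k \<le> Z \<and> 0 \<le> v \<bullet> Z}"
    unfolding H(2) by (auto simp: vw)
  finally show ?case
    using fg_pos_subsemimodule_mat_image[OF right_po_coherent_row[OF coh, of v k] H(1)]
    by (simp add: v_def)
qed

lemma fg_nonneg_solutions_in_cone:
  fixes W :: "'r::po_ring mat"
  assumes coh: "right_po_coherent TYPE('r)"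
    and W: "W \<in> carrier_mat m n" and S: "fg_pos_subsemimodule m S"
  shows "fg_pos_subsemimodule n {Y \<in> carrier_vec n. 0\<^sub>v n \<le> Y \<and> W *\<^sub>v Y \<in> S}"
proof -
  obtain k H where H: "H \<in> carrier_mat m k" "S = (*\<^sub>v) H ` {Z \<in> carrier_vec k. 0\<^sub>v k \<le> Z}"
    using S by (rule fg_pos_subsemimodule_matrix)
  \<comment> \<open>Each coordinate of the equation \<open>W *\<^sub>v Y = H *\<^sub>v Z\<close>
    becomes two opposite inequalities on the stacked vector \<open>Y @\<^sub>v Z\<close>, recombined
    by antisymmetry.\<close>
  define ws where "ws = (\<lambda>i. row W i @\<^sub>v - row H i) ` {..<m} \<union> (\<lambda>i. - row W i @\<^sub>v row H i) ` {..<m}"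
  let ?T = "{X \<in> carrier_vec (n + k). 0\<^sub>v (n + k) \<le> X \<and> (\<forall>w\<in>ws. 0 \<le> w \<bullet> X)}"
  have fgT: "fg_pos_subsemimodule (n + k) ?T"
    using W H by (intro right_po_coherent_system[OF coh]) (auto simp: ws_def)
  have system: "(\<forall>w\<in>ws. 0 \<le> w \<bullet> (Y @\<^sub>v Z)) \<longleftrightarrow> W *\<^sub>v Y = H *\<^sub>v Z"
    if Y: "Y \<in> carrier_vec n" and Z: "Z \<in> carrier_vec k" for Y Z
  proof -
    have "(row W i @\<^sub>v - row H i) \<bullet> (Y @\<^sub>v Z) = row W i \<bullet> Y - row H i \<bullet> Z"
      "(- row W i @\<^sub>v row H i) \<bullet> (Y @\<^sub>v Z) = row H i \<bullet> Z - row W i \<bullet> Y" if "i < m" for i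
      using W H(1) Y Z that by (auto simp: scalar_prod_append[where ?n1.0=n and ?n2.0=k])
    then have "(\<forall>w\<in>ws. 0 \<le> w \<bullet> (Y @\<^sub>v Z)) \<longleftrightarrow> (\<forall>i<m. row W i \<bullet> Y = row H i \<bullet> Z)"
      by (auto simp: ws_def ball_Un intro: antisym)
    then show ?thesis
      using W H(1) by (auto simp: vec_eq_iff)
  qed
  have nonneg: "0\<^sub>v (n + k) \<le> Y @\<^sub>v Z \<longleftrightarrow> 0\<^sub>v n \<le> Y \<and> 0\<^sub>v k \<le> Z"
    if "Y \<in> carrier_vec n" "Z \<in> carrier_vec k" for Y Z :: "'r vec"
  proof -
    have "0\<^sub>v (n + k) = 0\<^sub>v n @\<^sub>v (0\<^sub>v k :: 'r vec)"
      by auto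
    then show ?thesis
      using that append_vec_le[of "0\<^sub>v n" n Y "0\<^sub>v k" Z] by simp
  qed
  \<comment> \<open>Projecting to the first \<open>n\<close> coordinates eliminates the
    existentially quantified \<open>Z\<close>.\<close>
  have "{Y \<in> carrier_vec n. 0\<^sub>v n \<le> Y \<and> W *\<^sub>v Y \<in> S} = (\<lambda>X. vec_first X n) ` ?T"
  proof (intro equalityI subsetI)
    fix Y assume "Y \<in> {Y \<in> carrier_vec n. 0\<^sub>v n \<le> Y \<and> W *\<^sub>v Y \<in> S}"
    then obtain Z where Y: "Y \<in> carrier_vec n" "0\<^sub>v n \<le> Y"
      and Z: "Z \<in> carrier_vec k" "0\<^sub>v k \<le> Z" "W *\<^sub>v Y = H *\<^sub>v Z"
      by (auto simp: H)
    have "Y @\<^sub>v Z \<in> ?T"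
      using Y Z system nonneg by simp
    moreover have "vec_first (Y @\<^sub>v Z) n = Y"
      using Y by (auto simp: vec_first_def)
    ultimately show "Y \<in> (\<lambda>X. vec_first X n) ` ?T"
      by (intro image_eqI[of _ _ "Y @\<^sub>v Z"]) simp_all
  next
    fix Y assume "Y \<in> (\<lambda>X. vec_first X n) ` ?T"
    then obtain X where X: "X \<in> ?T" "Y = vec_first X n"
      by blast
    define Z where "Z = vec_last X k"
    have "X = Y @\<^sub>v Z" "Y \<in> carrier_vec n" "Z \<in> carrier_vec k"
      using X by (simp_all add: Z_def)
    then show "Y \<in> {Y \<in> carrier_vec n. 0\<^sub>v n \<le> Y \<and> W *\<^sub>v Y \<in> S}"
      using X(1) system nonneg by (auto simp: H)
  qed
  moreover have "fg_pos_subsemimodule n ((\<lambda>X. vec_first X n) ` ?T)"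
    by (rule fg_pos_subsemimodule_image[OF fgT]) (auto simp: vec_first_def)
  ultimately show ?thesis
    by simp
qed

section \<open>Rows over the module\<close>

context po_right_module
begin

lemma act_zero_left: "act 0 r = 0"
  using act_add_left[of 0 0 r] by simp

lemma act_zero_right: "act x 0 = 0"
  using act_add_right[of x 0 0] by simp

lemma act_sum_left: "act (\<Sum>i\<in>I. f i) r = (\<Sum>i\<in>I. act (f i) r)"
  by (induction I rule: infinite_finite_induct) (simp_all add: act_zero_left act_add_left)

lemma act_sum_right: "act x (\<Sum>i\<in>I. f i) = (\<Sum>i\<in>I. act x (f i))"
  by (induction I rule: infinite_finite_induct) (simp_all add: act_zero_right act_add_right)

text \<open>Spanning is defined by a hull; explicit coefficients exist because the combinations of
  \<open>U\<close> form a submodule containing its entries.\<close>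

lemma spanning_row_UNIV_combination:
  assumes "spanning_row act UNIV U"
  obtains X where "X \<in> carrier_vec (dim_vec U)" "a = row_times_col act U X"
proof -
  let ?B = "row_times_col act U ` carrier_vec (dim_vec U)"
  have "right_submodule act ?B"
    unfolding right_submodule_def
  proof (intro conjI ballI allI)
    have "0 = row_times_col act U (0\<^sub>v (dim_vec U))"
      by (simp add: row_times_col_def act_zero_right)
    then show "0 \<in> ?B"
      by (rule image_eqI) simp
  next
    fix x y assume "x \<in> ?B" "y \<in> ?B"
    then obtain X Y where "X \<in> carrier_vec (dim_vec U)" "x = row_times_col act U X"
      "Y \<in> carrier_vec (dim_vec U)" "y = row_times_col act U Y"
      by blast
    then have "x + y = row_times_col act U (X + Y)" "X + Y \<in> carrier_vec (dim_vec U)"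
      by (auto simp: row_times_col_def act_add_right sum.distrib)
    then show "x + y \<in> ?B"
      by blast
  next
    fix x r assume "x \<in> ?B"
    then obtain X where "X \<in> carrier_vec (dim_vec U)" "x = row_times_col act U X"
      by blast
    then have "act x r = row_times_col act U (map_vec (\<lambda>x. x * r) X)"
      "map_vec (\<lambda>x. x * r) X \<in> carrier_vec (dim_vec U)"
      by (auto simp: row_times_col_def act_mult act_sum_left)
    then show "act x r \<in> ?B"
      by blast
  qed
  moreover have "set\<^sub>v U \<subseteq> ?B"
  proof
    fix x assume "x \<in> set\<^sub>v U"
    then obtain i where i: "i < dim_vec U" "x = U $ i"
      by (auto simp: vec_set_def)
    let ?e = "vec (dim_vec U) (\<lambda>j. if j = i then 1 else 0)"
    have "row_times_col act U ?e = (\<Sum>j<dim_vec U. if j = i then U $ j else 0)"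
      unfolding row_times_col_def
      using i by (intro sum.cong) (auto simp: act_one act_zero_right)
    also have "\<dots> = x"
      using i by simp
    finally show "x \<in> ?B"
      by (intro image_eqI[of _ _ ?e]) simp_all
  qed
  ultimately have "right_submodule act hull (set\<^sub>v U) \<subseteq> ?B"
    by (intro hull_minimal)
  then have "a \<in> ?B"
    using assms by (auto simp: spanning_row_def)
  then show thesis
    using that by blast
qed

text \<open>Associativity for a row over the module: if \<open>V\<close> is \<open>U\<close> times
  \<open>W\<close>, the matrix can be moved over to the column \<open>Y\<close>.\<close>

lemma row_times_col_mult_mat_vec:
  assumes "W \<in> carrier_mat (dim_vec U) (dim_vec V)" "Y \<in> carrier_vec (dim_vec V)"
    and V: "\<And>j. j < dim_vec V \<Longrightarrow> V $ j = row_times_col act U (col W j)"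
  shows "row_times_col act V Y = row_times_col act U (W *\<^sub>v Y)"
proof -
  have "row_times_col act V Y
      = (\<Sum>j<dim_vec V. \<Sum>i<dim_vec U. act (U $ i) (W $$ (i, j) * Y $ j))"
    using assms(1) unfolding row_times_col_def[of act V]
    by (intro sum.cong) (auto simp: V row_times_col_def act_sum_left act_mult)
  also have "\<dots> = (\<Sum>i<dim_vec U. \<Sum>j<dim_vec V. act (U $ i) (W $$ (i, j) * Y $ j))"
    by (rule sum.swap)
  also have "\<dots> = row_times_col act U (W *\<^sub>v Y)"
    using assms(1,2) unfolding row_times_col_def[of act U]
    by (intro sum.cong) (auto simp: scalar_prod_def act_sum_right lessThan_atLeast0)
  finally show ?thesis .
qed

text \<open>Since \<open>V\<close> is an arbitrary row, this covers the spanning rows of every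
  finitely generated submodule at once.\<close>

lemma finitely_related_at_of_po_presented:
  assumes coh: "right_po_coherent TYPE('r)" and pres: "finitely_po_presented act"
  shows "finitely_related_at act V"
proof -
  obtain U where U: "spanning_row act UNIV U" "finitely_po_presented_at act U"
    using pres by (auto simp: finitely_po_presented_def)
  let ?m = "dim_vec U" and ?n = "dim_vec V"
  let ?S = "{X \<in> carrier_vec ?m. 0 \<le> row_times_col act U X}"
  \<comment> \<open>No bound on \<open>j\<close> is imposed: even out of range, \<open>V $ j\<close>
    denotes some element of the module, and \<open>U\<close> spans all of it.\<close>
  have "\<exists>X. X \<in> carrier_vec ?m \<and> V $ j = row_times_col act U X" for j
    using spanning_row_UNIV_combination[OF U(1)] by metis
  then obtain C where C: "\<And>j. C j \<in> carrier_vec ?m" "\<And>j. V $ j = row_times_col act U (C j)"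
    by metis
  define W where "W = mat ?m ?n (\<lambda>(i, j). C j $ i)"
  have W: "W \<in> carrier_mat ?m ?n"
    by (simp add: W_def)
  have "col W j = C j" if "j < ?n" for j
    using that C(1)[of j] by (auto simp: W_def)
  then have VW: "row_times_col act V Y = row_times_col act U (W *\<^sub>v Y)" if "Y \<in> carrier_vec ?n" for Y
    using that C(2) by (intro row_times_col_mult_mat_vec[OF W]) simp_all
  have "{Y \<in> carrier_vec ?n. 0 \<le> row_times_col act V Y \<and> 0\<^sub>v ?n \<le> Y}
      = {Y \<in> carrier_vec ?n. 0\<^sub>v ?n \<le> Y \<and> W *\<^sub>v Y \<in> ?S}"
    (is "?L = ?R")
    using W VW by fastforce
  moreover have "fg_pos_subsemimodule ?n ?R"
    using U(2) unfolding finitely_po_presented_at_def by (rule fg_nonneg_solutions_in_cone[OF coh W])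
  ultimately show ?thesis
    by (simp only: finitely_related_at_def)
qed

end

theorem theorem4p1:
  fixes act :: "'m::ordered_ab_group_add \<Rightarrow> 'r::po_ring \<Rightarrow> 'm"
  assumes "po_right_module act"
    and "right_po_coherent TYPE('r)"
    and "finitely_po_presented act"
  shows "po_coherent act"
  using po_right_module.finitely_related_at_of_po_presented[OF assms]
  by (simp add: po_coherent_def finitely_related_def)

end
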